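(* For every integer $g \ge 2$ there exists a constant $c > 0$ such that for all sufficiently large real $X$, $$\#\{ n < X : n \text{ is a sum of two base } g \text{ palindromes}\} \le \frac{X}{(\log X)^{c}}.$$
   Context: Fix an integer $g\ge 2$. Every positive integer $a$ can be uniquely written as $a=\sum_{i=0}^{n} a_i g^i$ with digits $a_i\in\{0,1,\dots,g-1\}$ and $a_n\neq 0$. Such an $a$ is a base $g$ palindrome if $a_i=a_{n-i}$ for all $i=0,\dots,n$. Here $n$ ranges over positive integers. *)

theory Defs
  imports Complex_Main
begin

text \<open>Palindromes are positive (so \<open>0\<close> is not one), and single-digit numbers are allowed (\<open>n = 0\<close>).
  For \<open>g \<ge> 2\<close> the top index \<open>n\<close> and the digits \<open>d 0, \<dots>, d n\<close> are determined by \<open>a\<close>;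
  the values of \<open>d\<close> beyond \<open>n\<close> are irrelevant.\<close>

definition palindrome :: "nat \<Rightarrow> nat \<Rightarrow> bool" where
  "palindrome g a \<longleftrightarrow> a > 0 \<and>
     (\<exists>(n::nat) (d::nat \<Rightarrow> nat).
        (\<forall>i\<le>n. d i < g) \<and> d n \<noteq> 0 \<and> a = (\<Sum>i\<le>n. d i * g ^ i) \<and>
        (\<forall>i\<le>n. d i = d (n - i)))"

end

theory Submission
  imports Defs "HOL-Library.FuncSet" "HOL-Real_Asymp.Real_Asymp"
begin

text \<open>
  Let \<open>p\<close> and \<open>q\<close> be palindromes with \<open>M + D\<close> and \<open>M\<close> digits. If, in the lower half,
  \<open>p\<close> has digits \<open>1, 0, \<dots>, 0, 1\<close> (with \<open>D\<close> zeros) from position \<open>k\<close> on and \<open>q\<close> has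
  digits \<open>0, 0\<close> from position \<open>k\<close> on, then replacing them by \<open>0, g - 1, \<dots>, g - 1, 0\<close> and
  \<open>1, 1\<close>, together with their mirror images, changes \<open>p\<close> and \<open>q\<close> by opposite amounts: both the low and
  the high change of \<open>p\<close> have absolute value \<open>g + 1\<close> times a power of \<open>g\<close>, and the reflections
  of \<open>p\<close> and \<open>q\<close> differ by a shift of \<open>D\<close>. Hence every sum is attained by a pair avoiding this
  pattern in all disjoint blocks of length \<open>D + 2\<close>, which saves a factor
  \<open>(1 - g ^ -(D + 4)) ^ J\<close> with about \<open>M / (2 * (D + 2))\<close> blocks. For numbers with at most \<open>n\<close> digits this is
  very small while \<open>D\<close> is below \<open>K = log g n / 4\<close>. If instead \<open>M \<le> n - K\<close>, there are only
  \<open>O(g ^ (n - K / 2))\<close> pairs, which saves a power of \<open>n\<close>.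
\<close>

section \<open>Palindromes as weighted sums of their lower half digits\<close>

text \<open>The amount gained when digit \<open>i\<close> and its mirror image both grow by one. The
  middle digit of an odd length is its own mirror image and counts once.\<close>

definition mirror_weight :: "nat \<Rightarrow> nat \<Rightarrow> nat \<Rightarrow> nat" where
  "mirror_weight g N i = (if 2 * i + 1 = N then g ^ i else g ^ i + g ^ (N - 1 - i))"

text \<open>Only the lower half of the digits \<open>f\<close> is used; leading zeros are allowed.\<close>

definition pal_value :: "nat \<Rightarrow> nat \<Rightarrow> (nat \<Rightarrow> nat) \<Rightarrow> nat" where
  "pal_value g N f = (\<Sum>i<(N + 1) div 2. f i * mirror_weight g N i)"

lemma pal_value_cong:
  "(\<And>i. i < (N + 1) div 2 \<Longrightarrow> f i = f' i) \<Longrightarrow> pal_value g N f = pal_value g N f'"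
  by (simp add: pal_value_def)

text \<open>The upper half of the digits is folded onto the lower half by \<open>i\<close> \<mapsto>
  \<open>N - 1 - i\<close>.\<close>

lemma sum_mirror:
  fixes d :: "nat \<Rightarrow> nat"
  assumes sym: "\<And>i. i < N \<Longrightarrow> d i = d (N - 1 - i)"
  shows "(\<Sum>i<N. d i * g ^ i) = pal_value g N d"
proof -
  let ?h = "(N + 1) div 2"
  have split: "{..<N} = {..<?h} \<union> {?h..<N}" by auto
  have "(\<Sum>i<N. d i * g ^ i) = (\<Sum>i<?h. d i * g ^ i) + (\<Sum>i\<in>{?h..<N}. d i * g ^ i)"
    by (subst split, rule sum.union_disjoint) auto
  also have "(\<Sum>i\<in>{?h..<N}. d i * g ^ i) = (\<Sum>i<N div 2. d i * g ^ (N - 1 - i))"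
  proof (rule sum.reindex_bij_witness[of _ "\<lambda>i. N - 1 - i" "\<lambda>i. N - 1 - i"])
    fix i assume i: "i \<in> {?h..<N}"
    then show "d (N - 1 - i) * g ^ (N - 1 - (N - 1 - i)) = d i * g ^ i"
      using sym[of i] by simp
  qed auto
  \<comment> \<open>Only a middle position lies below \<open>?h\<close> but not below
    \<open>N div 2\<close>; a zero term there lets both sums run over the same range.\<close>
  also have "\<dots> = (\<Sum>i<?h. if 2 * i + 1 = N then 0 else d i * g ^ (N - 1 - i))"
    by (rule sum.mono_neutral_cong_left) auto
  finally show ?thesis
    unfolding pal_value_def mirror_weight_def sum.distrib[symmetric]
    by (simp only:) (rule sum.cong, auto simp: distrib_left)
qed

text \<open>Here \<open>N\<close> is the number of digits. The nonzero leading digit gives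
  \<open>g ^ (N - 1) \<le> a\<close>, which later bounds the length by the size.\<close>

lemma palindrome_pal_value:
  assumes "palindrome g a"
  obtains N d where "a = pal_value g N d" "\<And>i. i < (N + 1) div 2 \<Longrightarrow> d i < g" "g ^ (N - 1) \<le> a"
proof -
  from assms obtain n and d :: "nat \<Rightarrow> nat" where d: "\<And>i. i \<le> n \<Longrightarrow> d i < g" "d n \<noteq> 0"
    "a = (\<Sum>i\<le>n. d i * g ^ i)" "\<And>i. i \<le> n \<Longrightarrow> d i = d (n - i)"
    unfolding palindrome_def by blast
  have "d i = d (Suc n - 1 - i)" if "i < Suc n" for i using d(4)[of i] that by simp
  from sum_mirror[of "Suc n" d g, OF this] have "a = pal_value g (Suc n) d"
    unfolding d(3) lessThan_Suc_atMost by blast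
  have "g ^ n \<le> d n * g ^ n" using d(2) by simp
  moreover have "d n * g ^ n \<le> a" unfolding d(3) by (rule member_le_sum) auto
  ultimately have "g ^ n \<le> a" by (rule order_trans)
  then have "g ^ (Suc n - 1) \<le> a" by simp
  with \<open>a = pal_value g (Suc n) d\<close> show ?thesis using d(1) by (intro that[of "Suc n" d]) auto
qed

subsection \<open>The switch\<close>

text \<open>A run of digits \<open>g - 1\<close> telescopes. The additive form avoids truncated
  subtraction.\<close>

lemma mult_geometric_block:
  fixes g :: nat assumes "g \<ge> 1"
  shows "(\<Sum>i\<in>{k<..k + D}. (g - 1) * g ^ i) + g ^ (k + 1) = g ^ (k + D + 1)"
proof (induction D)
  case (Suc D)
  have "{k<..k + Suc D} = insert (k + Suc D) {k<..k + D}" by auto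
  then show ?case using Suc assms by (cases g) auto
qed simp

lemma mult_geometric_block_mirror:
  fixes g :: nat assumes "g \<ge> 1" "k + D < N"
  shows "(\<Sum>i\<in>{k<..k + D}. (g - 1) * g ^ (N - 1 - i)) + g ^ (N - 1 - (k + D)) = g ^ (N - 1 - k)"
  using assms(2)
proof (induction D)
  case (Suc D)
  have e: "{k<..k + Suc D} = insert (k + Suc D) {k<..k + D}" by auto
  have "N - 1 - (k + D) = Suc (N - 1 - (k + Suc D))" using Suc.prems by auto
  then show ?case using Suc assms(1) unfolding e by (cases g) (auto simp del: One_nat_def)
qed simp

text \<open>The low powers and the high powers balance separately: in both, the run of digits
  \<open>g - 1\<close> telescopes, and its negative end cancels against one of the two units given
  to the shorter palindrome.\<close>

lemma switch_identity:
  fixes g :: nat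
  assumes "g \<ge> 1" "k + D + 2 \<le> M div 2"
  shows "mirror_weight g (M + D) k + mirror_weight g (M + D) (k + D + 1) =
    (\<Sum>i\<in>{k<..k + D}. (g - 1) * mirror_weight g (M + D) i) +
    mirror_weight g M k + mirror_weight g M (k + 1)"
proof -
  \<comment> \<open>All positions involved lie strictly below the middle, so the exceptional case of
    \<open>mirror_weight\<close> never occurs.\<close>
  have w: "mirror_weight g (M + D) i = g ^ i + g ^ (M + D - 1 - i)" if "i \<le> k + D + 1" for i
    using that assms(2) by (auto simp: mirror_weight_def)
  have w': "mirror_weight g M i = g ^ i + g ^ (M - 1 - i)" if "i \<le> k + 1" for i
    using that assms(2) by (auto simp: mirror_weight_def)
  have "(\<Sum>i\<in>{k<..k + D}. (g - 1) * mirror_weight g (M + D) i) =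
    (\<Sum>i\<in>{k<..k + D}. (g - 1) * g ^ i) + (\<Sum>i\<in>{k<..k + D}. (g - 1) * g ^ (M + D - 1 - i))"
    unfolding sum.distrib[symmetric] by (intro sum.cong refl) (simp add: w distrib_left)
  moreover have "k < M" using assms(2) by auto
  \<comment> \<open>The last two positions of the block in length \<open>M + D\<close> have the same
    mirror images as \<open>k\<close> and \<open>k + 1\<close> in length \<open>M\<close>. This ties
    the block length to the difference \<open>D\<close> of the lengths.\<close>
  moreover have "M + D - 1 - (k + D) = M - 1 - k" "M + D - 1 - (k + D + 1) = M - 1 - (k + 1)"
    using assms(2) by auto
  ultimately show ?thesis
    using mult_geometric_block[OF assms(1), of k D]
      mult_geometric_block_mirror[OF assms(1), of k D "M + D"] assms(2) \<open>k < M\<close>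
    by (simp add: w w')
qed

text \<open>The pair \<open>f\<close>, \<open>f'\<close> carries the pattern and \<open>h\<close>,
  \<open>h'\<close> is the pair after the switch. Digits outside the block cancel, which leaves
  \<open>switch_identity\<close>.\<close>

lemma pal_value_switch:
  fixes g :: nat
  assumes g: "g \<ge> 1" and k: "k + D + 2 \<le> M div 2"
    and p: "f k = 1" "\<And>i. i \<in> {k<..k + D} \<Longrightarrow> f i = 0" "f (k + D + 1) = 1"
    and q: "f' k = 0" "f' (k + 1) = 0"
    and p': "h k = 0" "\<And>i. i \<in> {k<..k + D} \<Longrightarrow> h i = g - 1" "h (k + D + 1) = 0"
      "\<And>i. i \<notin> {k..k + D + 1} \<Longrightarrow> h i = f i"
    and q': "h' k = 1" "h' (k + 1) = 1" "\<And>i. i \<notin> {k, k + 1} \<Longrightarrow> h' i = f' i"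
  shows "pal_value g (M + D) f + pal_value g M f' = pal_value g (M + D) h + pal_value g M h'"
proof -
  let ?W = "mirror_weight g (M + D)" and ?w = "mirror_weight g M"
  let ?A = "{..<(M + D + 1) div 2}" and ?B = "{k..k + D + 1}" and ?C = "{..<(M + 1) div 2}"
  have sub: "?B \<subseteq> ?A" "{k, k + 1} \<subseteq> ?C" using k by auto
  have B: "?B = insert k (insert (k + D + 1) {k<..k + D})" by auto
  have F: "pal_value g (M + D) u = sum (\<lambda>i. u i * ?W i) (?A - ?B) +
      (u k * ?W k + u (k + D + 1) * ?W (k + D + 1) + (\<Sum>i\<in>{k<..k + D}. u i * ?W i))" for u
  proof -
    have "sum (\<lambda>i. u i * ?W i) ?B =
        u k * ?W k + u (k + D + 1) * ?W (k + D + 1) + (\<Sum>i\<in>{k<..k + D}. u i * ?W i)"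
      unfolding B by simp
    then show ?thesis
      unfolding pal_value_def using sum.subset_diff[OF sub(1), of "\<lambda>i. u i * ?W i"] by simp
  qed
  have G: "pal_value g M u = sum (\<lambda>i. u i * ?w i) (?C - {k, k + 1}) +
      (u k * ?w k + u (k + 1) * ?w (k + 1))" for u
    unfolding pal_value_def using sum.subset_diff[OF sub(2), of "\<lambda>i. u i * ?w i"] by simp
  have "(\<Sum>i\<in>{k<..k + D}. f i * ?W i) = 0" using p(2) by simp
  moreover have "(\<Sum>i\<in>{k<..k + D}. h i * ?W i) = (\<Sum>i\<in>{k<..k + D}. (g - 1) * ?W i)"
    using p'(2) by (intro sum.cong) auto
  moreover have "sum (\<lambda>i. h i * ?W i) (?A - ?B) = sum (\<lambda>i. f i * ?W i) (?A - ?B)"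
    using p'(4) by (intro sum.cong) auto
  moreover have "sum (\<lambda>i. h' i * ?w i) (?C - {k, k + 1}) = sum (\<lambda>i. f' i * ?w i) (?C - {k, k + 1})"
    using q'(3) by (intro sum.cong) auto
  ultimately show ?thesis
    using switch_identity[OF g k] p p' q q' unfolding F G by simp
qed

subsection \<open>Counting\<close>

text \<open>Blocks are split off one at a time: on a block of size \<open>l\<close> one of the
  \<open>g ^ l\<close> assignments is forbidden, and by disjointness the remaining conditions
  concern only the other positions. Each block thus costs a factor
  \<open>1 - 1 / g ^ l\<close>.\<close>

lemma card_PiE_avoid_patterns:
  fixes g :: nat and \<pi> :: "'a \<Rightarrow> nat"
  assumes "finite I" "\<And>j. j < J \<Longrightarrow> B j \<subseteq> I" "\<And>j. j < J \<Longrightarrow> card (B j) = l"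
    "\<And>i j. i < J \<Longrightarrow> j < J \<Longrightarrow> i \<noteq> j \<Longrightarrow> B i \<inter> B j = {}"
    "\<And>x. x \<in> I \<Longrightarrow> \<pi> x < g"
  shows "real (card {F \<in> I \<rightarrow>\<^sub>E {..<g}. \<forall>j<J. \<exists>x\<in>B j. F x \<noteq> \<pi> x}) \<le>
    real g ^ card I * (1 - 1 / real g ^ l) ^ J"
  using assms
proof (induction J arbitrary: I)
  case 0
  then show ?case by (simp add: card_PiE)
next
  case (Suc J)
  let ?S = "\<lambda>I J. {F \<in> I \<rightarrow>\<^sub>E {..<g}. \<forall>j<J. \<exists>x\<in>B j. F x \<noteq> \<pi> x}"
  let ?K = "B J" and ?R = "I - B J"
  have KI: "?K \<subseteq> I" and cK: "card ?K = l" using Suc.prems(2,3) by auto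
  have finK: "finite ?K" using KI Suc.prems(1) by (rule finite_subset)
  have disj: "B j \<inter> ?K = {}" if "j < J" for j using that Suc.prems(4)[of j J] by auto
  let ?T = "(?K \<rightarrow>\<^sub>E {..<g}) - {restrict \<pi> ?K}"
  let ?\<phi> = "\<lambda>F. (restrict F ?K, restrict F ?R)"
  have finT: "finite ?T" using finK by (auto intro: finite_PiE)
  have finS: "finite (?S ?R J)"
    by (rule finite_subset[OF _ finite_PiE[of ?R "\<lambda>_. {..<g}"]]) (use Suc.prems in auto)
  have "card (?S I (Suc J)) \<le> card (?T \<times> ?S ?R J)"
  proof (rule card_inj_on_le[of ?\<phi>])
    show "inj_on ?\<phi> (?S I (Suc J))"
    proof (rule inj_onI)
      fix F F' assume F: "F \<in> ?S I (Suc J)" and F': "F' \<in> ?S I (Suc J)" and e: "?\<phi> F = ?\<phi> F'"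
      have "F x = F' x" if "x \<in> I" for x
        using e that by (cases "x \<in> ?K") (auto dest: fun_cong[of _ _ x])
      then show "F = F'" using F F' by (auto intro!: PiE_ext[of F I _ F'])
    qed
    show "?\<phi> ` ?S I (Suc J) \<subseteq> ?T \<times> ?S ?R J"
    proof
      fix y assume "y \<in> ?\<phi> ` ?S I (Suc J)"
      then obtain F where y: "y = ?\<phi> F" and F: "F \<in> I \<rightarrow>\<^sub>E {..<g}"
        and a: "\<forall>j<Suc J. \<exists>x\<in>B j. F x \<noteq> \<pi> x" by blast
      have "restrict F ?K \<in> ?K \<rightarrow>\<^sub>E {..<g}" "restrict F ?R \<in> ?R \<rightarrow>\<^sub>E {..<g}"
        using F KI by (auto simp: PiE_iff)
      moreover obtain x where "x \<in> ?K" "F x \<noteq> \<pi> x" using a by auto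
      then have "restrict F ?K \<noteq> restrict \<pi> ?K" by (auto dest: fun_cong[of _ _ x])
      moreover have "\<exists>x\<in>B j. restrict F ?R x \<noteq> \<pi> x" if j: "j < J" for j
      proof -
        obtain x where x: "x \<in> B j" "F x \<noteq> \<pi> x" using a j by (meson less_Suc_eq)
        moreover have "x \<in> ?R" using x(1) disj[OF j] Suc.prems(2)[of j] j by auto
        ultimately show ?thesis by auto
      qed
      ultimately show "y \<in> ?T \<times> ?S ?R J" unfolding y by blast
    qed
    show "finite (?T \<times> ?S ?R J)" using finT finS by auto
  qed
  then have le: "real (card (?S I (Suc J))) \<le> real (card ?T) * real (card (?S ?R J))"
    by (simp only: card_cartesian_product of_nat_mult[symmetric] of_nat_le_iff)
  have "restrict \<pi> ?K \<in> ?K \<rightarrow>\<^sub>E {..<g}" using Suc.prems(5) KI by auto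
  then have cT: "card ?T = g ^ l - 1" using finK cK by (simp add: card_PiE)
  \<comment> \<open>Positivity of \<open>g\<close> is not assumed; a nonempty block forces it, since
    \<open>\<pi>\<close> takes values below \<open>g\<close> there.\<close>
  have "g ^ l \<ge> 1"
  proof (cases "l = 0")
    case False
    then obtain x where "x \<in> ?K" using cK by fastforce
    then show ?thesis using Suc.prems(5)[of x] KI by auto
  qed auto
  then have "real (card (?S I (Suc J))) \<le> (real g ^ l - 1) * real (card (?S ?R J))"
    using le unfolding cT by (simp add: of_nat_diff)
  also have "\<dots> \<le> (real g ^ l - 1) * (real g ^ card ?R * (1 - 1 / real g ^ l) ^ J)"
  proof (rule mult_left_mono)
    show "real (card (?S ?R J)) \<le> real g ^ card ?R * (1 - 1 / real g ^ l) ^ J"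
    proof (rule Suc.IH)
      show "B j \<subseteq> ?R" if "j < J" for j using disj[OF that] Suc.prems(2)[of j] that by auto
    qed (use Suc.prems in auto)
    show "0 \<le> real g ^ l - 1" using \<open>g ^ l \<ge> 1\<close>
      by (metis diff_ge_0_iff_ge of_nat_1 of_nat_le_iff of_nat_power)
  qed
  also have "\<dots> = real g ^ card I * (1 - 1 / real g ^ l) ^ Suc J"
  proof -
    have "card I = l + card ?R"
      using card_Diff_subset[OF finK KI] cK card_mono[OF Suc.prems(1) KI] by auto
    moreover have "real g ^ l > 0" using \<open>g ^ l \<ge> 1\<close>
      by (metis of_nat_0_less_iff of_nat_power less_le_trans zero_less_one)
    then have "real g ^ l - 1 = real g ^ l * (1 - 1 / real g ^ l)" by (simp add: field_simps)
    ultimately show ?thesis by (simp only: power_add power_Suc mult_ac)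
  qed
  finally show ?case .
qed

text \<open>Leading zeros are allowed so that a switch at position 0, which turns a leading 1 into
  0, stays within the class.\<close>

definition pal_sums :: "nat \<Rightarrow> nat \<Rightarrow> nat \<Rightarrow> nat set" where
  "pal_sums g N M = {pal_value g N f + pal_value g M f' |f f'.
     (\<forall>i<(N + 1) div 2. f i < g) \<and> (\<forall>i<(M + 1) div 2. f' i < g)}"

text \<open>Every sum has a representation without a switchable block, so it suffices to count digit
  assignments avoiding the pattern. A block has \<open>D + 2\<close> digits of the longer palindrome
  and 2 of the shorter one, whence \<open>D + 4\<close>.\<close>

lemma card_pal_sums:
  fixes g :: nat
  assumes g: "g \<ge> 2"
  shows "finite (pal_sums g (M + D) M)"
    and "real (card (pal_sums g (M + D) M)) \<le>
      real g ^ ((M + D + 1) div 2 + (M + 1) div 2) *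
        (1 - 1 / real g ^ (D + 4)) ^ (M div 2 div (D + 2))"
proof -
  let ?hp = "(M + D + 1) div 2" and ?hq = "(M + 1) div 2" and ?L = "D + 2"
  \<comment> \<open>Both lower halves are coded as one function on tagged positions:
    \<open>False\<close> marks the longer palindrome and \<open>True\<close> the shorter
    one.\<close>
  define I where "I = {False} \<times> {..<?hp} \<union> {True} \<times> {..<?hq}"
  define J where "J = M div 2 div ?L"
  define B where "B j = {False} \<times> {j * ?L..<j * ?L + ?L} \<union> {True} \<times> {j * ?L, j * ?L + 1}" for j
  \<comment> \<open>The pattern 1, 0, ..., 0, 1 against 0, 0, repeated with period
    \<open>D + 2\<close> so that one function serves all blocks.\<close>
  define \<pi> :: "bool \<times> nat \<Rightarrow> nat"
    where "\<pi> = (\<lambda>(c, i). if \<not> c \<and> (i mod ?L = 0 \<or> i mod ?L = D + 1) then 1 else 0)"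
  define s where "s F = pal_value g (M + D) (\<lambda>i. F (False, i)) + pal_value g M (\<lambda>i. F (True, i))"
    for F :: "bool \<times> nat \<Rightarrow> nat"
  define S where "S = {F \<in> I \<rightarrow>\<^sub>E {..<g}. \<forall>j<J. \<exists>x\<in>B j. F x \<noteq> \<pi> x}"
  have finI: "finite I" by (auto simp: I_def)
  have cI: "card I = ?hp + ?hq" unfolding I_def
    by (subst card_Un_disjoint) (auto simp: card_cartesian_product)
  have top: "j * ?L + ?L \<le> M div 2" if "j < J" for j
  proof -
    have "(j + 1) * ?L \<le> J * ?L" using that by (intro mult_right_mono) auto
    also have "\<dots> \<le> M div 2" unfolding J_def by (rule div_times_less_eq_dividend)
    finally show ?thesis by simp
  qed
  have BI: "B j \<subseteq> I" if "j < J" for j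
    using top[OF that] by (auto simp: B_def I_def)
  have cB: "card (B j) = D + 4" for j unfolding B_def
    by (subst card_Un_disjoint) (auto simp: card_cartesian_product)
  have Bdiv: "snd x div ?L = j" if "x \<in> B j" for x j
    using that by (intro div_nat_eqI) (auto simp: B_def algebra_simps)
  have disj: "B i \<inter> B j = {}" if "i \<noteq> j" for i j using Bdiv that by blast
  have finP: "finite (I \<rightarrow>\<^sub>E {..<g})" using finI by (intro finite_PiE) auto
  have finS: "finite S" unfolding S_def by (rule finite_subset[OF _ finP]) auto
  have "real (card S) \<le> real g ^ card I * (1 - 1 / real g ^ (D + 4)) ^ J"
    unfolding S_def by (rule card_PiE_avoid_patterns[OF finI BI cB disj]) (use g in \<open>auto simp: \<pi>_def\<close>)
  moreover have sub: "pal_sums g (M + D) M \<subseteq> s ` S"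
  proof
    fix n assume "n \<in> pal_sums g (M + D) M"
    then obtain f f' where n: "n = pal_value g (M + D) f + pal_value g M f'"
      and f: "\<And>i. i < ?hp \<Longrightarrow> f i < g" and f': "\<And>i. i < ?hq \<Longrightarrow> f' i < g"
      unfolding pal_sums_def by auto
    let ?F0 = "restrict (\<lambda>(c, i). if c then f' i else f i) I"
    let ?R = "{F \<in> I \<rightarrow>\<^sub>E {..<g}. s F = n}"
    let ?m = "\<lambda>F. \<Sum>i<?hq. F (True, i)"
    have "s ?F0 = n" unfolding s_def n
      by (intro arg_cong2[of _ _ _ _ "(+)"] pal_value_cong) (auto simp: I_def)
    moreover have "?F0 \<in> I \<rightarrow>\<^sub>E {..<g}" using f f' by (auto simp: I_def)
    ultimately have ne: "?R \<noteq> {}" by blast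
    have finR: "finite ?R" by (rule finite_subset[OF _ finP]) auto
    \<comment> \<open>Among the representations of \<open>n\<close> take one with the largest half digit sum of the
      second summand: every switch would enlarge it.\<close>
    have "Max (?m ` ?R) \<in> ?m ` ?R" using finR ne by (intro Max_in finite_imageI) simp_all
    then obtain F where mF: "Max (?m ` ?R) = ?m F" and F: "F \<in> ?R" by (rule imageE)
    have max: "?m G \<le> ?m F" if "G \<in> ?R" for G
      unfolding mF[symmetric] by (intro Max_ge finite_imageI finR imageI that)
    have "\<exists>x\<in>B j. F x \<noteq> \<pi> x" if j: "j < J" for j
    proof (rule ccontr)
      assume "\<not> ?thesis"
      then have bad: "\<And>x. x \<in> B j \<Longrightarrow> F x = \<pi> x" by auto
      define k where "k = j * ?L"
      have k: "k + D + 2 \<le> M div 2" using top[OF j] by (simp add: k_def)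
      have Bk: "B j = {False} \<times> {k..<k + D + 2} \<union> {True} \<times> {k, k + 1}"
        by (simp add: B_def k_def)
      have \<pi>F: "\<pi> (False, k + t) = (if t = 0 \<or> t = D + 1 then 1 else 0)" if "t < D + 2" for t
      proof -
        have "(k + t) mod ?L = t mod ?L" unfolding k_def by (rule mod_mult_self3)
        then show ?thesis using that by (auto simp: \<pi>_def)
      qed
      have \<pi>T: "\<pi> (True, i) = 0" for i by (simp add: \<pi>_def)
      \<comment> \<open>\<open>G\<close> is the pair obtained from \<open>F\<close> by the switch in
        block \<open>j\<close>.\<close>
      define G where "G = (\<lambda>(c, i). if (c, i) \<in> B j
        then (if c then 1 else if i = k \<or> i = k + D + 1 then 0 else g - 1) else F (c, i))"
      have "G \<in> I \<rightarrow>\<^sub>E {..<g}" using F g BI[OF j] by (auto simp: G_def PiE_iff extensional_def)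
      moreover have "s F = s G" unfolding s_def
      proof (rule pal_value_switch[OF _ k])
        show "F (False, k) = 1" "F (False, k + D + 1) = 1"
          using bad[of "(False, k)"] bad[of "(False, k + D + 1)"] \<pi>F[of 0] \<pi>F[of "D + 1"]
          by (auto simp: Bk)
        show "F (False, i) = 0" if "i \<in> {k<..k + D}" for i
          using bad[of "(False, i)"] \<pi>F[of "i - k"] that by (auto simp: Bk)
        show "F (True, k) = 0" "F (True, k + 1) = 0"
          using bad[of "(True, k)"] bad[of "(True, k + 1)"] \<pi>T by (auto simp: Bk)
      qed (use g in \<open>auto simp: G_def Bk\<close>)
      ultimately have "?m G \<le> ?m F" using max F by auto
      \<comment> \<open>In the shorter palindrome the switch only turns two zeros into ones, which
        contradicts the maximality of \<open>F\<close>.\<close>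
      moreover have "?m F < ?m G"
      proof (rule sum_strict_mono_ex1)
        have T: "F (True, i) = 0" if "i \<in> {k, k + 1}" for i
          using bad[of "(True, i)"] \<pi>T that by (auto simp: Bk)
        then show "\<forall>i\<in>{..<?hq}. F (True, i) \<le> G (True, i)" by (auto simp: G_def Bk)
        show "\<exists>i\<in>{..<?hq}. F (True, i) < G (True, i)"
          using k T[of k] by (intro bexI[of _ k]) (auto simp: G_def Bk)
      qed simp
      ultimately show False by simp
    qed
    then have "F \<in> S" using F by (auto simp: S_def)
    then show "n \<in> s ` S" using F by auto
  qed
  ultimately show "real (card (pal_sums g (M + D) M)) \<le>
      real g ^ (?hp + ?hq) * (1 - 1 / real g ^ (D + 4)) ^ (M div 2 div (D + 2))"
    using card_mono[OF finite_imageI[OF finS] sub] card_image_le[OF finS, of s]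
    unfolding cI J_def by linarith
  show "finite (pal_sums g (M + D) M)" using sub finS by (meson finite_imageI finite_subset)
qed

section \<open>Summation over all pairs of lengths up to \<open>n\<close>\<close>

lemma sum_power_half_le:
  fixes g :: nat assumes "g \<ge> 2"
  shows "(\<Sum>N\<le>n. g ^ ((N + 1) div 2)) \<le> 4 * g ^ ((n + 1) div 2)"
proof (induction n rule: nat_induct2)
  case (step n)
  let ?x = "g ^ ((n + 1) div 2)"
  have "(\<Sum>N\<le>n + 2. g ^ ((N + 1) div 2)) = (\<Sum>N\<le>n. g ^ ((N + 1) div 2)) + g * g ^ (n div 2) + g * ?x"
  proof -
    have "{..n + 2} = insert (n + 2) (insert (n + 1) {..n})" by auto
    then show ?thesis by simp
  qed
  moreover have "g * g ^ (n div 2) \<le> g * ?x"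
    using assms by (intro mult_left_mono power_increasing div_le_mono) auto
  \<comment> \<open>The constant 4 reproduces itself: \<open>4 * ?x\<close> is at most
    \<open>2 * (g * ?x)\<close>, and the two new terms add at most \<open>g * ?x\<close>
    each.\<close>
  moreover have "2 * ?x \<le> g * ?x" using assms by (rule mult_right_mono) simp
  moreover have "g ^ ((n + 2 + 1) div 2) = g * ?x" by simp
  ultimately show ?case using step by linarith
qed (use assms in auto)

definition pals :: "nat \<Rightarrow> nat \<Rightarrow> nat set" where
  "pals g n = (\<Union>N\<le>n. pal_value g N ` ({..<(N + 1) div 2} \<rightarrow>\<^sub>E {..<g}))"

lemma card_pals:
  assumes "g \<ge> 2"
  shows "finite (pals g n)" "card (pals g n) \<le> 4 * g ^ ((n + 1) div 2)"
proof -
  show "finite (pals g n)" unfolding pals_def by (intro finite_UN_I finite_imageI finite_PiE) auto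
  have "card (pals g n) \<le> (\<Sum>N\<le>n. card (pal_value g N ` ({..<(N + 1) div 2} \<rightarrow>\<^sub>E {..<g})))"
    unfolding pals_def by (rule card_UN_le) simp
  also have "\<dots> \<le> (\<Sum>N\<le>n. card ({..<(N + 1) div 2} \<rightarrow>\<^sub>E {..<g}))"
    by (intro sum_mono card_image_le finite_PiE) auto
  also have "\<dots> = (\<Sum>N\<le>n. g ^ ((N + 1) div 2))" by (simp add: card_PiE)
  finally show "card (pals g n) \<le> 4 * g ^ ((n + 1) div 2)"
    using sum_power_half_le[OF assms, of n] by linarith
qed

lemma pal_value_in_pals:
  assumes "N \<le> n" "\<And>i. i < (N + 1) div 2 \<Longrightarrow> f i < g"
  shows "pal_value g N f \<in> pals g n"
proof -
  have "pal_value g N f = pal_value g N (restrict f {..<(N + 1) div 2})"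
    by (rule pal_value_cong) simp
  then show ?thesis unfolding pals_def using assms by (auto simp del: One_nat_def intro!: bexI[of _ N])
qed

text \<open>Both summands have at most \<open>n\<close> digits. If the shorter one has at most
  \<open>n - K\<close>, the pairs are counted trivially (\<open>S\<close>); otherwise the lengths
  differ by less than \<open>K\<close> and \<open>card_pal_sums\<close> applies (\<open>T\<close>).
  The parameter \<open>K\<close> is left free to balance the two terms.\<close>

lemma card_sums_le:
  fixes g :: nat
  assumes g: "g \<ge> 2" and X: "X \<le> real g ^ n" and K: "K \<le> n"
  shows "real (card {n::nat. n > 0 \<and> real n < X \<and>
      (\<exists>a b. palindrome g a \<and> palindrome g b \<and> n = a + b)}) \<le>
    16 * real g ^ ((n + 1) div 2 + (n - K + 1) div 2) + real K * (real n + 1) *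
      (real g ^ (n + 1) * (1 - 1 / real g ^ (K + 4)) ^ ((n - K) div 2 div (K + 2)))"
    (is "real (card ?A) \<le> _ + _ * ?E")
proof -
  define S where "S = (\<lambda>(x, y). x + y) ` (pals g n \<times> pals g (n - K))"
  define I where "I = {(D, M). D < K \<and> M \<le> n \<and> n - K < M \<and> M + D \<le> n}"
  define T where "T = (\<Union>(D, M)\<in>I. pal_sums g (M + D) M)"
  have fin: "finite (pals g n \<times> pals g (n - K))" using card_pals(1)[OF g] by simp
  have I: "I \<subseteq> {..<K} \<times> {..n}" by (auto simp: I_def)
  have finI: "finite I" using I by (rule finite_subset) simp
  have "card S \<le> card (pals g n \<times> pals g (n - K))" unfolding S_def by (rule card_image_le[OF fin])
  also have "\<dots> \<le> (4 * g ^ ((n + 1) div 2)) * (4 * g ^ ((n - K + 1) div 2))"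
    unfolding card_cartesian_product by (intro mult_mono card_pals g) auto
  also have "\<dots> = 16 * g ^ ((n + 1) div 2 + (n - K + 1) div 2)" by (simp add: power_add)
  finally have "real (card S) \<le> real (16 * g ^ ((n + 1) div 2 + (n - K + 1) div 2))"
    by (rule of_nat_mono)
  then have cS: "real (card S) \<le> 16 * real g ^ ((n + 1) div 2 + (n - K + 1) div 2)" by simp

  \<comment> \<open>The bound is made uniform over \<open>I\<close>: replacing \<open>D\<close> by
    \<open>K\<close> weakens the saving per block, and \<open>M > n - K\<close> guarantees enough
    blocks.\<close>
  have one: "real (card (pal_sums g (M + D) M)) \<le> ?E" if "(D, M) \<in> I" for D M
  proof -
    have DM: "D < K" "M \<le> n" "n - K < M" "M + D \<le> n" using that by (auto simp: I_def)
    have g1: "real g \<ge> 1" using g by simp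
    have r: "0 \<le> 1 - 1 / real g ^ (D + 4)" "1 - 1 / real g ^ (D + 4) \<le> 1 - 1 / real g ^ (K + 4)"
      "1 - 1 / real g ^ (K + 4) \<le> 1"
    proof -
      have "1 \<le> real g ^ (D + 4)" by (rule one_le_power[OF g1])
      moreover have "real g ^ (D + 4) \<le> real g ^ (K + 4)"
        using DM g1 by (intro power_increasing) auto
      ultimately show "0 \<le> 1 - 1 / real g ^ (D + 4)"
        "1 - 1 / real g ^ (D + 4) \<le> 1 - 1 / real g ^ (K + 4)" "1 - 1 / real g ^ (K + 4) \<le> 1"
        using g frac_le[of 1 1 "real g ^ (D + 4)" "real g ^ (K + 4)"]
          frac_le[of 1 1 1 "real g ^ (D + 4)"] by auto
    qed
    have "(n - K) div 2 div (K + 2) \<le> (n - K) div 2 div (D + 2)"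
      using DM by (intro div_le_mono2) auto
    also have "\<dots> \<le> M div 2 div (D + 2)" using DM by (intro div_le_mono) auto
    finally have J: "(n - K) div 2 div (K + 2) \<le> M div 2 div (D + 2)" .
    have "real (card (pal_sums g (M + D) M)) \<le> real g ^ ((M + D + 1) div 2 + (M + 1) div 2) *
        (1 - 1 / real g ^ (D + 4)) ^ (M div 2 div (D + 2))"
      by (rule card_pal_sums(2)[OF g])
    also have "\<dots> \<le> real g ^ (n + 1) * (1 - 1 / real g ^ (K + 4)) ^ ((n - K) div 2 div (K + 2))"
    proof (rule mult_mono)
      show "real g ^ ((M + D + 1) div 2 + (M + 1) div 2) \<le> real g ^ (n + 1)"
        using DM g1 by (intro power_increasing) auto
      have "(1 - 1 / real g ^ (D + 4)) ^ (M div 2 div (D + 2)) \<le>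
          (1 - 1 / real g ^ (D + 4)) ^ ((n - K) div 2 div (K + 2))"
        using r J by (intro power_decreasing) auto
      also have "\<dots> \<le> (1 - 1 / real g ^ (K + 4)) ^ ((n - K) div 2 div (K + 2))"
        using r by (intro power_mono) auto
      finally show "(1 - 1 / real g ^ (D + 4)) ^ (M div 2 div (D + 2)) \<le>
          (1 - 1 / real g ^ (K + 4)) ^ ((n - K) div 2 div (K + 2))" .
    qed (use r in auto)
    finally show ?thesis .
  qed
  have finT: "finite T" unfolding T_def using finI card_pal_sums(1)[OF g] by auto
  have "card T \<le> (\<Sum>(D, M)\<in>I. card (pal_sums g (M + D) M))"
    unfolding T_def using card_UN_le[OF finI, of "\<lambda>(D, M). pal_sums g (M + D) M"]
    by (simp add: case_prod_beta)
  then have "real (card T) \<le> (\<Sum>(D, M)\<in>I. real (card (pal_sums g (M + D) M)))"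
    by (metis (no_types, lifting) case_prod_beta of_nat_le_iff of_nat_sum sum.cong)
  also have "\<dots> \<le> (\<Sum>x\<in>I. ?E)" using one by (intro sum_mono) auto
  also have "\<dots> = real (card I) * ?E" by simp
  also have "\<dots> \<le> (real K * (real n + 1)) * ?E"
  proof (rule mult_right_mono)
    have "card I \<le> K * (n + 1)" using card_mono[OF _ I] by (simp add: card_cartesian_product)
    then have "real (card I) \<le> real (K * (n + 1))" by (rule of_nat_mono)
    then show "real (card I) \<le> real K * (real n + 1)" by (simp add: algebra_simps)
    have "1 \<le> real g ^ (K + 4)" using g by (intro one_le_power) auto
    then have "0 \<le> 1 - 1 / real g ^ (K + 4)" using g by (simp add: field_simps del: power_add)
    then show "0 \<le> ?E" by (intro mult_nonneg_nonneg zero_le_power) auto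
  qed
  finally have cT: "real (card T) \<le> real K * (real n + 1) * ?E" .

  \<comment> \<open>The first summand is taken to be the longer one; the symmetric case is recovered
    at the end by commutativity.\<close>
  have sym: "a + b \<in> S \<union> T"
    if "a = pal_value g N f" "\<And>i. i < (N + 1) div 2 \<Longrightarrow> f i < g" "N \<le> n"
      "b = pal_value g M f'" "\<And>i. i < (M + 1) div 2 \<Longrightarrow> f' i < g" "M \<le> N" for a b N M f f'
  proof (cases "M \<le> n - K")
    case True
    then show ?thesis using that pal_value_in_pals[of N n f g] pal_value_in_pals[of M "n - K" f' g]
      unfolding S_def by (auto intro!: image_eqI[of _ _ "(a, b)"])
  next
    case False
    then have "(N - M, M) \<in> I" using that K by (auto simp: I_def)
    moreover have "a + b \<in> pal_sums g (M + (N - M)) M" unfolding pal_sums_def using that by auto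
    ultimately show ?thesis unfolding T_def by blast
  qed
  have len: "N \<le> n" if "g ^ (N - 1) \<le> a" "real a < X" for N a
  proof -
    have "real (g ^ (N - 1)) \<le> real a" using that(1) by (rule of_nat_mono)
    then have "real g ^ (N - 1) < real g ^ n" using that(2) X unfolding of_nat_power by linarith
    then show ?thesis using g by (simp add: power_strict_increasing_iff)
  qed
  have "?A \<subseteq> S \<union> T"
  proof clarify
    fix a b assume p: "palindrome g a" "palindrome g b" and X': "real (a + b) < X" and "a + b \<notin> T"
    obtain N f where N: "a = pal_value g N f" "\<And>i. i < (N + 1) div 2 \<Longrightarrow> f i < g" "g ^ (N - 1) \<le> a"
      using palindrome_pal_value[OF p(1)] by blast
    obtain M f' where M: "b = pal_value g M f'" "\<And>i. i < (M + 1) div 2 \<Longrightarrow> f' i < g" "g ^ (M - 1) \<le> b"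
      using palindrome_pal_value[OF p(2)] by blast
    have "N \<le> n" "M \<le> n" using len[OF N(3)] len[OF M(3)] X' by auto
    then show "a + b \<in> S"
      using sym[OF N(1,2) _ M(1,2)] sym[OF M(1,2) _ N(1,2)] \<open>a + b \<notin> T\<close>
      by (cases "M \<le> N") (auto simp: add.commute)
  qed
  then have "card ?A \<le> card (S \<union> T)"
    using finT fin by (intro card_mono) (auto simp: S_def)
  then have "real (card ?A) \<le> real (card S) + real (card T)" using card_Un_le[of S T] by linarith
  then show ?thesis using cS cT by linarith
qed

section \<open>Asymptotics for a logarithmic choice of \<open>K\<close>\<close>

text \<open>The first term decays like \<open>x powr (- 1 / 8)\<close>, which beats the factor with
  exponent 1/16. In the second, the exponent is of order \<open>- x powr (3 / 4) / ln x\<close>,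
  which beats every power of \<open>x\<close>.\<close>

lemma bound_eventually_small:
  fixes G :: real
  assumes "G \<ge> 2"
  shows "eventually (\<lambda>x::real. G\<^sup>2 * (16 * G * x powr (- 1 / 8) + ln x * (x + 1) *
    exp (- ((x - ln x) / (2 * (ln x + 2)) - 1) / (G ^ 4 * x powr (1 / 4)))) *
    (x * ln G) powr (1 / 16) \<le> 1) at_top"
proof -
  have "G > 0" "ln G > 0" using assms by auto
  then show ?thesis by real_asymp
qed

text \<open>With this \<open>K\<close>, \<open>G ^ K\<close> is at most
  \<open>x powr (1 / 4)\<close>: small enough that the many blocks make the second term tiny, yet
  large enough that \<open>G powr (- K / 2)\<close> saves about \<open>x powr (- 1 / 8)\<close> in
  the first.\<close>

lemma bound_at_log_length:
  fixes G :: real and n :: nat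
  assumes G: "G \<ge> 2" and n: "n \<ge> 1"
  defines "x \<equiv> real n"
  defines "K \<equiv> nat \<lfloor>log G x / 4\<rfloor>"
  shows "K \<le> n"
    and "16 * G ^ ((n + 1) div 2 + (n - K + 1) div 2) + real K * (real n + 1) *
      (G ^ (n + 1) * (1 - 1 / G ^ (K + 4)) ^ ((n - K) div 2 div (K + 2))) \<le>
    G ^ (n + 1) * (16 * G * x powr (- 1 / 8) + ln x * (x + 1) *
      exp (- ((x - ln x) / (2 * (ln x + 2)) - 1) / (G ^ 4 * x powr (1 / 4))))"
proof -
  define J where "J = (n - K) div 2 div (K + 2)"
  have x: "x \<ge> 1" using n by (simp add: x_def)
  then have lnx: "ln x \<ge> 0" by simp
  have log0: "log G x \<ge> 0" using x G by simp
  have K1: "real K \<le> log G x / 4" and K2: "log G x / 4 - 1 \<le> real K"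
    unfolding K_def using log0 by linarith+
  have "ln 2 \<le> ln G" using G by simp
  \<comment> \<open>A crude bound from \<open>ln (1 / 2) \<le> - 1 / 2\<close>; it suffices to
    replace \<open>K\<close> by \<open>ln x\<close>, which is free of the base.\<close>
  then have lnG: "1 / 2 \<le> ln G" using ln_le_minus_one[of "1 / 2"] by (simp add: ln_div)
  then have "ln x * 1 \<le> ln x * (4 * ln G)" using lnx by (intro mult_left_mono) auto
  then have "log G x / 4 \<le> ln x" using lnG by (simp add: log_def field_simps)
  then have Kln: "real K \<le> ln x" using K1 by linarith
  also have "ln x \<le> x" using ln_le_minus_one[of x] x by linarith
  finally show Kn: "K \<le> n" by (simp add: x_def)
  have GK: "G ^ K \<le> x powr (1 / 4)"
  proof -
    have "G ^ K = G powr real K" using G by (simp add: powr_realpow)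
    also have "\<dots> \<le> G powr (log G x * (1 / 4))" using K1 G by (intro powr_mono) auto
    also have "\<dots> = x powr (1 / 4)" using G x by (subst powr_powr[symmetric]) simp
    finally show ?thesis .
  qed
  let ?e = "(n + 1) div 2 + (n - K + 1) div 2"
  have first: "G ^ ?e \<le> G ^ (n + 1) * (G * x powr (- 1 / 8))"
  proof -
    have "2 * ?e + K \<le> 2 * n + 2" using Kn by presburger
    then have "real (2 * ?e + K) \<le> real (2 * n + 2)" by (rule of_nat_mono)
    \<comment> \<open>The floor in \<open>K\<close> costs at most 1/2 in the exponent; rounding up
      to \<open>n + 2\<close> accounts for the extra factor \<open>G\<close>.\<close>
    then have e: "real ?e \<le> real (n + 2) + log G x * (- 1 / 8)" using K2 by simp
    have "G ^ ?e = G powr real ?e" using G by (simp only: powr_realpow)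
    also have "\<dots> \<le> G powr (real (n + 2) + log G x * (- 1 / 8))" using e G by (intro powr_mono) auto
    also have "\<dots> = G powr real (n + 2) * (G powr log G x) powr (- 1 / 8)"
      by (simp only: powr_add powr_powr)
    also have "\<dots> = G ^ (n + 2) * x powr (- 1 / 8)"
      using G x by (simp only: powr_realpow) simp
    finally show ?thesis by (simp add: mult_ac)
  qed
  have J: "(x - ln x) / (2 * (ln x + 2)) - 1 \<le> real J"
  proof -
    \<comment> \<open>The nested floors merge into one, so in total less than one block is
      lost.\<close>
    have "J = (n - K) div (2 * (K + 2))" by (simp only: J_def div_mult2_eq)
    then have "n - K < 2 * (K + 2) + 2 * (K + 2) * J"
      using dividend_less_times_div[of "2 * (K + 2)" "n - K"] by simp
    then have "real (n - K) \<le> real (2 * (K + 2) + 2 * (K + 2) * J)"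
      by (intro of_nat_mono less_imp_le)
    then have "real (n - K) \<le> (real J + 1) * real (2 * (K + 2))"
      by (simp add: algebra_simps)
    then have "real (n - K) / real (2 * (K + 2)) - 1 \<le> real J"
      by (simp add: pos_divide_le_eq diff_le_eq del: of_nat_mult of_nat_add)
    moreover have "(x - ln x) / (2 * (ln x + 2)) \<le> (x - real K) / (2 * (real K + 2))"
      using Kln lnx Kn by (intro frac_le) (auto simp: x_def)
    ultimately show ?thesis using Kn by (simp add: x_def of_nat_diff add.commute)
  qed
  have "(1 - 1 / G ^ (K + 4)) ^ J \<le>
      exp (- ((x - ln x) / (2 * (ln x + 2)) - 1) / (G ^ 4 * x powr (1 / 4)))"
  proof -
    have "1 \<le> G ^ (K + 4)" using G by (intro one_le_power) auto
    \<comment> \<open>This uses \<open>1 - t \<le> exp (- t)\<close> in every block.\<close>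
    then have "(1 - 1 / G ^ (K + 4)) ^ J \<le> exp (- (1 / G ^ (K + 4))) ^ J"
      using exp_ge_add_one_self[of "- (1 / G ^ (K + 4))"] by (intro power_mono) auto
    also have "\<dots> = exp (- (real J / G ^ (K + 4)))" by (simp add: exp_of_nat_mult[symmetric])
    also have "\<dots> \<le> exp (- (((x - ln x) / (2 * (ln x + 2)) - 1) / (G ^ 4 * x powr (1 / 4))))"
    proof -
      have "((x - ln x) / (2 * (ln x + 2)) - 1) / (G ^ 4 * x powr (1 / 4)) \<le>
          real J / (G ^ 4 * x powr (1 / 4))"
        using J G by (intro divide_right_mono) auto
      also have "\<dots> \<le> real J / G ^ (K + 4)"
      proof (rule divide_left_mono)
        show "G ^ (K + 4) \<le> G ^ 4 * x powr (1 / 4)"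
          using mult_left_mono[OF GK, of "G ^ 4"] G by (simp add: power_add mult.commute)
      qed (use G x in auto)
      finally show ?thesis by simp
    qed
    finally show ?thesis by (simp only: minus_divide_left)
  qed
  then have second: "real K * (real n + 1) * (G ^ (n + 1) * (1 - 1 / G ^ (K + 4)) ^ J) \<le>
      ln x * (x + 1) * (G ^ (n + 1) *
        exp (- ((x - ln x) / (2 * (ln x + 2)) - 1) / (G ^ 4 * x powr (1 / 4))))"
    using Kln lnx G x one_le_power[of G "K + 4"]
    by (intro mult_mono mult_nonneg_nonneg) (auto simp: x_def)
  have distr: "G ^ (n + 1) * (16 * G * y + l * u) =
      16 * (G ^ (n + 1) * (G * y)) + l * (G ^ (n + 1) * u)" for y l u
    by (simp add: algebra_simps)
  show "16 * G ^ ?e + real K * (real n + 1) * (G ^ (n + 1) *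
      (1 - 1 / G ^ (K + 4)) ^ ((n - K) div 2 div (K + 2))) \<le>
    G ^ (n + 1) * (16 * G * x powr (- 1 / 8) + ln x * (x + 1) *
      exp (- ((x - ln x) / (2 * (ln x + 2)) - 1) / (G ^ 4 * x powr (1 / 4))))"
    unfolding distr using first second[unfolded J_def] by linarith
qed

theorem theorem1:
  fixes g :: nat
  assumes "g \<ge> 2"
  shows "\<exists>c::real. c > 0 \<and>
    (\<forall>\<^sub>F X::real in at_top.
      real (card {n::nat. n > 0 \<and> real n < X \<and>
                   (\<exists>a b. palindrome g a \<and> palindrome g b \<and> n = a + b)})
        \<le> X / (ln X) powr c)"
proof (intro exI conjI)
  define G where "G = real g"
  have G: "G \<ge> 2" using assms by (simp add: G_def)
  \<comment> \<open>For \<open>X > 1\<close> this gives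
    \<open>G ^ (n X - 1) \<le> X < G ^ n X\<close>, so \<open>G ^ (n X + 1)\<close> exceeds
    \<open>X\<close> by a factor of at most \<open>G\<^sup>2\<close>.\<close>
  define n where "n X = nat \<lfloor>log G X\<rfloor> + 1" for X
  define h where "h x = 16 * G * x powr (- 1 / 8) + ln x * (x + 1) *
      exp (- ((x - ln x) / (2 * (ln x + 2)) - 1) / (G ^ 4 * x powr (1 / 4)))" for x :: real
  have "filterlim (log G) at_top at_top" using G by real_asymp
  then have "filterlim (\<lambda>X. real (n X)) at_top at_top"
    by (rule filterlim_at_top_mono) (auto simp: n_def intro!: always_eventually, linarith)
  then have "\<forall>\<^sub>F X in at_top. G\<^sup>2 * h (real (n X)) * (real (n X) * ln G) powr (1 / 16) \<le> 1"
    using eventually_compose_filterlim[OF bound_eventually_small[OF G]] by (simp add: h_def)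
  \<comment> \<open>The saving is of order \<open>n X\<close> to the power -1/8, and
    \<open>n X\<close> is comparable to \<open>ln X\<close>; the exponent 1/16 leaves room for all
    constants.\<close>
  then show "\<forall>\<^sub>F X::real in at_top.
      real (card {n::nat. n > 0 \<and> real n < X \<and>
                   (\<exists>a b. palindrome g a \<and> palindrome g b \<and> n = a + b)})
        \<le> X / (ln X) powr (1 / 16)"
    using eventually_gt_at_top[of 1]
  proof eventually_elim
    case (elim X)
    let ?n = "n X" and ?K = "nat \<lfloor>log G (real (n X)) / 4\<rfloor>"
    have log0: "log G X \<ge> 0" using elim(2) G by simp
    then have n: "?n \<ge> 1" "real ?n - 1 \<le> log G X" "log G X < real ?n"
      unfolding n_def by linarith+
    have GX: "G powr log G X = X" using elim(2) G by simp
    have "G powr log G X \<le> G powr real ?n" using n(3) G by (intro powr_mono) auto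
    then have up: "X \<le> G ^ ?n" unfolding GX using G by (simp add: powr_realpow)
    have "G powr (real (?n + 1) - 2) \<le> G powr log G X" using n(2) G by (intro powr_mono) auto
    then have "G ^ (?n + 1) / G\<^sup>2 \<le> X"
      unfolding GX powr_diff using G by (simp only: powr_realpow) simp
    then have low: "G ^ (?n + 1) \<le> G\<^sup>2 * X" using G by (simp add: field_simps)
    have h0: "0 \<le> h (real ?n)" using n(1) G by (simp add: h_def)
    have "ln X = log G X * ln G" using G by (simp add: log_def)
    also have "\<dots> \<le> real ?n * ln G" using n(3) G by (intro mult_right_mono) auto
    finally have "ln X powr (1 / 16) \<le> (real ?n * ln G) powr (1 / 16)"
      using elim(2) by (intro powr_mono2) auto
    then have "G\<^sup>2 * h (real ?n) * ln X powr (1 / 16) \<le> 1"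
      using elim(1) h0 by (smt (verit) mult_left_mono zero_le_power2 mult_nonneg_nonneg)
    then have small: "G\<^sup>2 * h (real ?n) \<le> 1 / ln X powr (1 / 16)"
      using elim(2) by (simp add: field_simps)
    have "real (card {n::nat. n > 0 \<and> real n < X \<and>
        (\<exists>a b. palindrome g a \<and> palindrome g b \<and> n = a + b)}) \<le> G ^ (?n + 1) * h (real ?n)"
      using card_sums_le[OF assms up[unfolded G_def] bound_at_log_length(1)[OF G n(1), unfolded G_def]]
        bound_at_log_length(2)[OF G n(1)]
      unfolding G_def h_def by linarith
    also have "\<dots> \<le> (G\<^sup>2 * X) * h (real ?n)" using low h0 by (rule mult_right_mono)
    also have "\<dots> = X * (G\<^sup>2 * h (real ?n))" by simp
    also have "\<dots> \<le> X * (1 / ln X powr (1 / 16))"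
      using small elim(2) by (intro mult_left_mono) auto
    finally show ?case by simp
  qed
qed simp

end
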